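(* Let $k\geq 1$, $M$ a finite set of positive integers, $T\in\mathcal{T}_M(k)$ and $x\in M$. Then $\Phi_x(T)\in\mathcal{T}_M(k)$. Moreover, the node labeled $x$ is an old internal node of $T$ if and only if the node labeled $x$ is a young leaf of $\Phi_x(T)$, and for every label $y\neq x$, the node labeled $y$ has the same type in $\Phi_x(T)$ as in $T$ (old or young, leaf or internal node).
   Context: Trees: all trees are ordered (plane) rooted trees; the level of a node is its distance from the root (root at level 0); a leaf is a node with no children. An even $k$-ary tree is an ordered tree in which every node on an even level has exactly $k$ children. A pruned even $k$-ary tree is obtained from an even $k$-ary tree by deleting, for every even-level node all of whose children are leaves, all those children. An increasing pruned even $k$-ary tree on $M$ is a pruned even $k$-ary tree whose nodes on even levels are labeled bijectively by $M$ (odd-level nodes unlabeled) such that labels increase along every path from the root downward and, for each node, the labels of its children increase from left to right; $\mathcal{T}_M(k)$ is the set of them. A labeled node is a leaf if it has no children and an internal node otherwise. For a labeled node $v$, its grand parent is the labeled node $u$ such that a child of $u$ is the parent of $v$ ($v$ is a grand child of $u$). A labeled non-root node $v$ is old if its label is the greatest among all grand children of its grand parent, and young otherwise; the root is neither old nor young. The map $\Phi_x$: let $v$ be the node labeled $x$ in $T$. (i) If $v$ is an old internal node, let $u$ be its grand parent, $\mu_1,\dots,\mu_k$ the children of $u$ from left to right, and $\nu_1,\dots,\nu_k$ the children of $v$ from left to right; for each $j\in[k]$ delete $\nu_j$ (and its edge to $v$) and attach the subtrees rooted at the children of $\nu_j$ as subtrees of $\mu_j$, ordering the children of $\mu_j$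 increasingly from left to right; the result is $\Phi_x(T)$. (ii) If $v$ is a young leaf, let $u$ be its grand parent and $\mu_1,\dots,\mu_k$ the children of $u$ from left to right; for $j\in[k]$ let $F_j$ be the set of subtrees of $\mu_j$ whose roots have labels greater than $x$. Attach $k$ new unlabeled children $\nu_1,\dots,\nu_k$ (left to right) to $v$, and for each $j$ remove the subtrees in $F_j$ from $\mu_j$ and attach them to $\nu_j$, ordering the children of $\nu_j$ increasingly; the result is $\Phi_x(T)$. (iii) Otherwise $\Phi_x(T)=T$. *)

theory Defs
  imports Main "HOL-Library.Sublist"
begin

datatype 'a otree = Node (lab: 'a) (kids: "'a otree list")

text \<open>
  A node is addressed by the list of child indices (from 0) leading to it from the root;
  the root is the empty list and the level of a node is the length of its address.
\<close>

fun is_node :: "'a otree \<Rightarrow> nat list \<Rightarrow> bool" where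
  "is_node t [] \<longleftrightarrow> True"
| "is_node t (i # p) \<longleftrightarrow> i < length (kids t) \<and> is_node (kids t ! i) p"

fun subtree :: "'a otree \<Rightarrow> nat list \<Rightarrow> 'a otree" where
  "subtree t [] = t"
| "subtree t (i # p) = subtree (kids t ! i) p"

fun replace_at :: "'a otree \<Rightarrow> nat list \<Rightarrow> 'a otree \<Rightarrow> 'a otree" where
  "replace_at t [] s = s"
| "replace_at t (i # p) s = Node (lab t) ((kids t)[i := replace_at (kids t ! i) p s])"

definition nodes :: "'a otree \<Rightarrow> nat list set" where
  "nodes t = {p. is_node t p}"

definition is_leaf :: "'a otree \<Rightarrow> nat list \<Rightarrow> bool" where
  "is_leaf t p \<longleftrightarrow> p \<in> nodes t \<and> kids (subtree t p) = []"

definition is_internal :: "'a otree \<Rightarrow> nat list \<Rightarrow> bool" where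
  "is_internal t p \<longleftrightarrow> p \<in> nodes t \<and> kids (subtree t p) \<noteq> []"

definition even_kary :: "nat \<Rightarrow> 'a otree \<Rightarrow> bool" where
  "even_kary k t \<longleftrightarrow> (\<forall>p\<in>nodes t. even (length p) \<longrightarrow> length (kids (subtree t p)) = k)"

text \<open>
  The flag tells whether the root of the argument lies on an even level of the whole tree.
  Whether a child is a leaf is decided in the original tree, so all deletions are simultaneous.
\<close>

fun prune :: "bool \<Rightarrow> 'a otree \<Rightarrow> 'a otree" where
  "prune ev (Node a ts) =
     Node a (if ev \<and> (\<forall>s\<in>set ts. kids s = []) then [] else map (prune (\<not> ev)) ts)"

definition shape :: "'a otree \<Rightarrow> unit otree" where
  "shape t = map_otree (\<lambda>_. ()) t"

definition pruned_even_kary :: "nat \<Rightarrow> 'a otree \<Rightarrow> bool" where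
  "pruned_even_kary k t \<longleftrightarrow> (\<exists>s. even_kary k s \<and> shape t = prune True s)"

text \<open>Node labels have type \<^typ>\<open>nat option\<close>, where \<^term>\<open>None\<close> means unlabeled.\<close>

definition labeled_nodes :: "nat option otree \<Rightarrow> nat list set" where
  "labeled_nodes t = {p \<in> nodes t. lab (subtree t p) \<noteq> None}"

definition label :: "nat option otree \<Rightarrow> nat list \<Rightarrow> nat" where
  "label t p = the (lab (subtree t p))"

definition inc_trees :: "nat \<Rightarrow> nat set \<Rightarrow> nat option otree set" where
  "inc_trees k M = {t.
     pruned_even_kary k t \<and>
     labeled_nodes t = {p \<in> nodes t. even (length p)} \<and>
     bij_betw (label t) (labeled_nodes t) M \<and>
     (\<forall>p\<in>labeled_nodes t. \<forall>q\<in>labeled_nodes t. strict_prefix p q \<longrightarrow> label t p < label t q) \<and>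
     (\<forall>p\<in>nodes t. \<forall>i j. i < j \<and> p @ [i] \<in> labeled_nodes t \<and> p @ [j] \<in> labeled_nodes t
        \<longrightarrow> label t (p @ [i]) < label t (p @ [j]))}"

definition node_of :: "nat option otree \<Rightarrow> nat \<Rightarrow> nat list" where
  "node_of t x = (THE p. p \<in> labeled_nodes t \<and> label t p = x)"

definition grandparent :: "nat list \<Rightarrow> nat list" where
  "grandparent p = butlast (butlast p)"

definition grandchildren :: "nat option otree \<Rightarrow> nat list \<Rightarrow> nat list set" where
  "grandchildren t u = {v \<in> labeled_nodes t. \<exists>i j. v = u @ [i, j]}"

definition is_old :: "nat option otree \<Rightarrow> nat list \<Rightarrow> bool" where
  "is_old t v \<longleftrightarrow> v \<in> labeled_nodes t \<and> v \<noteq> [] \<and>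
     (\<forall>w\<in>grandchildren t (grandparent v). label t w \<le> label t v)"

definition is_young :: "nat option otree \<Rightarrow> nat list \<Rightarrow> bool" where
  "is_young t v \<longleftrightarrow> v \<in> labeled_nodes t \<and> v \<noteq> [] \<and> \<not> is_old t v"

definition sort_by_label :: "nat option otree list \<Rightarrow> nat option otree list" where
  "sort_by_label ts = sort_key (\<lambda>s. the (lab s)) ts"

text \<open>
  Case (i). \<^term>\<open>U\<close> is the subtree at the grand parent \<^term>\<open>u\<close> of \<^term>\<open>v\<close> after all children
  \<open>\<nu>\<^sub>j\<close> of \<^term>\<open>v\<close> are deleted. Both lists of children that are zipped have length \<open>k\<close>.
\<close>

definition merge_up :: "nat option otree \<Rightarrow> nat list \<Rightarrow> nat option otree" where
  "merge_up t v =
    (let u = grandparent v;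
         V = subtree t v;
         U = subtree (replace_at t v (Node (lab V) [])) u
     in replace_at t u
          (Node (lab U)
             (map2 (\<lambda>\<mu> \<nu>. Node (lab \<mu>) (sort_by_label (kids \<mu> @ kids \<nu>))) (kids U) (kids V))))"

text \<open>
  Case (ii). \<^term>\<open>\<nu>s\<close> are the new children of \<^term>\<open>v\<close>, one for each child \<open>\<mu>\<^sub>j\<close> of the grand
  parent, carrying the subtrees in \<open>F\<^sub>j\<close>; \<^term>\<open>U\<close> is the subtree at the grand parent
  after attaching them, from which the \<open>F\<^sub>j\<close> have still to be removed.
\<close>

definition split_down :: "nat option otree \<Rightarrow> nat list \<Rightarrow> nat option otree" where
  "split_down t v =
    (let u = grandparent v;
         x = label t v;
         \<nu>s = map (\<lambda>\<mu>. Node None (sort_by_label (filter (\<lambda>s. the (lab s) > x) (kids \<mu>))))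
                  (kids (subtree t u));
         U = subtree (replace_at t v (Node (lab (subtree t v)) \<nu>s)) u
     in replace_at t u
          (Node (lab U)
             (map (\<lambda>\<mu>. Node (lab \<mu>) (filter (\<lambda>s. \<not> the (lab s) > x) (kids \<mu>))) (kids U))))"

definition Phi :: "nat \<Rightarrow> nat option otree \<Rightarrow> nat option otree" where
  "Phi x t =
    (let v = node_of t x
     in if is_old t v \<and> is_internal t v then merge_up t v
        else if is_young t v \<and> is_leaf t v then split_down t v
        else t)"

end

theory Submission
  imports Defs "HOL-Library.Multiset"
begin

text \<open>
  Both membership in \<^const>\<open>inc_trees\<close> and the type of a node can be read off from the multiset, over
  all even-level nodes, of the label of the node together with the rows of labels of its grand
  children. Case (i) of \<^const>\<open>Phi\<close> changes only the data of \<open>x\<close> and of its grand parent: the rows of \<open>x\<close>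
  are merged into those of the grand parent. As \<open>x\<close> was the greatest entry there and all moved
  labels exceed \<open>x\<close>, the greatest of the moved labels becomes the greatest grand child, so all other
  nodes keep their types while \<open>x\<close> becomes a young leaf. Case (ii) is the reverse exchange.
\<close>

text \<open>The obstacle is that the moves re-sort rows of children, so the address of a node, and
  of everything below it, can shift; nodes of the two trees cannot be matched by position. A
  multiset of label data carries no addresses. It still determines membership because every
  condition becomes local. Increase along paths follows from the comparison of each node with its
  grand children. Being pruned from an even k-ary tree amounts to: each even-level node is
  childless, or has exactly k children that are not all childless. Bijectivity of the labeling says
  that the multiset of first components is that of M without repetition. Since each move exchanges
  two data for two others with the same labels, bijectivity is inherited at once, and what remains
  is a comparison of two sets of numbers separated by x.\<close>

section \<open>Addresses on even levels, and induction that descends two levels at a time\<close>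

lemma otree_grandchild_induct [case_names grandchild]:
  assumes "\<And>t. (\<And>c s. c \<in> set (kids t) \<Longrightarrow> s \<in> set (kids c) \<Longrightarrow> P s) \<Longrightarrow> P t"
  shows "P t"
proof (induction t rule: measure_induct_rule[where f = size])
  case (less t)
  show ?case
  proof (rule assms)
    fix c s assume c: "c \<in> set (kids t)" and s: "s \<in> set (kids c)"
    have "size c < size t"
      using c by (cases t) (auto dest: size_list_estimation'[OF _ order_refl, where f = size])
    moreover have "size s < size c"
      using s by (cases c) (auto dest: size_list_estimation'[OF _ order_refl, where f = size])
    ultimately show "P s" by (intro less) simp
  qed
qed

lemma is_node_append: "is_node t (p @ q) \<longleftrightarrow> is_node t p \<and> is_node (subtree t p) q"
  by (induction t p rule: is_node.induct) auto

lemma subtree_append: "subtree t (p @ q) = subtree (subtree t p) q"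
  by (induction t p rule: subtree.induct) auto

lemma subtree_replace_at_append:
  "is_node t p \<Longrightarrow> subtree (replace_at t (p @ q) s) p = replace_at (subtree t p) q s"
  by (induction t p rule: is_node.induct) auto

lemma lab_replace_at: "lab s = lab (subtree t p) \<Longrightarrow> lab (replace_at t p s) = lab t"
  by (cases p) auto

text \<open>In an increasing tree these are the labeled nodes. Defining them without labels lets the
  multiset be formed before the tree is known to be increasing.\<close>

definition even_nodes :: "'a otree \<Rightarrow> nat list set" where
  "even_nodes t = {p \<in> nodes t. even (length p)}"

lemma Nil_even_nodes [simp]: "[] \<in> even_nodes t"
  by (simp add: even_nodes_def nodes_def)

lemma Cons_Cons_even_nodes:
  "i # j # p \<in> even_nodes t \<longleftrightarrow>
     i < length (kids t) \<and> j < length (kids (kids t ! i)) \<and> p \<in> even_nodes (kids (kids t ! i) ! j)"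
  by (auto simp: even_nodes_def nodes_def)

lemma even_nodes_unfold:
  "even_nodes t = insert [] ((\<lambda>(i, j, p). i # j # p) `
     (SIGMA i:{..<length (kids t)}. SIGMA j:{..<length (kids (kids t ! i))}.
        even_nodes (kids (kids t ! i) ! j)))" (is "_ = ?R")
proof (rule set_eqI)
  fix p :: "nat list"
  consider "p = []" | i where "p = [i]" | i j q where "p = i # j # q"
    by (metis list.exhaust)
  then show "p \<in> even_nodes t \<longleftrightarrow> p \<in> ?R"
  proof cases
    case (2 i)
    then show ?thesis by (auto simp: even_nodes_def)
  next
    case (3 i j q)
    then show ?thesis by (force simp: Cons_Cons_even_nodes)
  qed simp
qed

lemma finite_even_nodes [simp]: "finite (even_nodes t)"
proof (induction t rule: otree_grandchild_induct)
  case (grandchild t)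
  then have "finite (even_nodes (kids (kids t ! i) ! j))"
    if "i < length (kids t)" "j < length (kids (kids t ! i))" for i j
    using that by (meson nth_mem)
  then show ?case by (subst even_nodes_unfold) (auto intro!: finite_SigmaI finite_imageI)
qed

lemma even_nodes_append:
  "p \<in> even_nodes t \<Longrightarrow> p @ q \<in> even_nodes t \<longleftrightarrow> q \<in> even_nodes (subtree t p)"
  by (auto simp: even_nodes_def nodes_def is_node_append)

lemma ball_even_nodes:
  "(\<forall>p\<in>even_nodes t. P (subtree t p)) \<longleftrightarrow>
     P t \<and> (\<forall>c\<in>set (kids t). \<forall>s\<in>set (kids c). \<forall>p\<in>even_nodes s. P (subtree s p))"
  by (subst even_nodes_unfold) (simp add: all_set_conv_all_nth split_paired_all, blast)

lemma even_kary_unfold: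
  "even_kary k t \<longleftrightarrow>
     length (kids t) = k \<and> (\<forall>c\<in>set (kids t). \<forall>s\<in>set (kids c). even_kary k s)"
  using ball_even_nodes[of t "\<lambda>s. length (kids s) = k"]
  by (auto simp: even_kary_def even_nodes_def)

section \<open>Pruned even k-ary trees by a local condition\<close>

lemma kids_shape: "kids (shape t) = map shape (kids t)"
  by (cases t) (simp add: shape_def)

lemma kids_prune_True:
  "kids (prune True t) = (if \<forall>s\<in>set (kids t). kids s = [] then [] else map (prune False) (kids t))"
  by (cases t) simp

lemma kids_prune_False: "kids (prune False t) = map (prune True) (kids t)"
  by (cases t) simp

text \<open>A surviving even-level node loses its children exactly when all of them are leaves in
  \<open>s\<close>. Otherwise it keeps all k, and a child that has children in \<open>s\<close>
  keeps them, because nothing is deleted directly below an odd level.\<close>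

lemma pruned_even_karyD:
  assumes "even_kary k s" "shape t = prune True s" "p \<in> even_nodes t"
  shows "kids (subtree t p) = [] \<or>
    length (kids (subtree t p)) = k \<and> (\<exists>c\<in>set (kids (subtree t p)). kids c \<noteq> [])"
proof -
  let ?P = "\<lambda>t::'a otree. kids t = [] \<or> length (kids t) = k \<and> (\<exists>c\<in>set (kids t). kids c \<noteq> [])"
  have "\<forall>p\<in>even_nodes t. ?P (subtree t p)"
    using assms(1,2)
  proof (induction s arbitrary: t rule: otree_grandchild_induct)
    case (grandchild s)
    have ks: "map shape (kids t) = kids (prune True s)"
      using grandchild.prems kids_shape by metis
    show ?case
    proof (cases "\<forall>c\<in>set (kids s). kids c = []")
      case True
      then have "kids t = []" using ks by (simp add: kids_prune_True)
      then show ?thesis by (subst ball_even_nodes) simp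
    next
      case False
      then have ks: "map shape (kids t) = map (prune False) (kids s)"
        using ks by (subst (asm) kids_prune_True) (simp only: if_False)
      then have len: "length (kids t) = length (kids s)" by (metis length_map)
      have sub: "map shape (kids (kids t ! i)) = map (prune True) (kids (kids s ! i))"
        if "i < length (kids s)" for i
        using that ks len by (metis kids_prune_False kids_shape nth_map)
      then have sublen: "length (kids (kids t ! i)) = length (kids (kids s ! i))"
        if "i < length (kids s)" for i
        using that by (metis length_map)
      have "?P t"
      proof -
        obtain i where i: "i < length (kids s)" "kids (kids s ! i) \<noteq> []"
          using False by (auto simp: in_set_conv_nth)
        then have "kids t ! i \<in> set (kids t)" "kids (kids t ! i) \<noteq> []"
          using len sublen[of i] by auto
        moreover have "length (kids t) = k"
          using grandchild.prems(1) len even_kary_unfold by metis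
        ultimately show ?thesis by blast
      qed
      moreover have "\<forall>p\<in>even_nodes g. ?P (subtree g p)"
        if cg: "c \<in> set (kids t)" "g \<in> set (kids c)" for c g
      proof -
        obtain i where i: "i < length (kids s)" "c = kids t ! i"
          using cg(1) len by (auto simp: in_set_conv_nth)
        then obtain j where j: "j < length (kids (kids s ! i))" "g = kids (kids t ! i) ! j"
          using cg(2) sublen[of i] by (auto simp: in_set_conv_nth)
        note ij = i(1) j
        have "shape g = prune True (kids (kids s ! i) ! j)"
          using ij sub[of i] sublen[of i] by (metis nth_map)
        moreover have "even_kary k (kids (kids s ! i) ! j)"
          using grandchild.prems(1) ij by (subst (asm) even_kary_unfold) (meson nth_mem)
        ultimately show ?thesis
          using grandchild.IH[of "kids s ! i" "kids (kids s ! i) ! j" g] ij by simp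
      qed
      ultimately show ?thesis by (subst ball_even_nodes) blast
    qed
  qed
  then show ?thesis using assms(3) by blast
qed

text \<open>A preimage under pruning: childless even-level nodes get k leaves back. Pruning then
  deletes only these leaves, provided every other even-level node has a child with children, which
  is the hypothesis of \<open>pruned_even_karyI\<close>.\<close>

fun unprune :: "nat \<Rightarrow> bool \<Rightarrow> 'a otree \<Rightarrow> unit otree" where
  "unprune k ev (Node a ts) =
     Node () (if ev \<and> ts = [] then replicate k (Node () []) else map (unprune k (\<not> ev)) ts)"

lemma kids_unprune_True:
  "kids (unprune k True t) =
    (if kids t = [] then replicate k (Node () []) else map (unprune k False) (kids t))"
  by (cases t) simp

lemma kids_unprune_False: "kids (unprune k False t) = map (unprune k True) (kids t)"
  by (cases t) simp

lemma pruned_even_karyI: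
  assumes "\<And>p. p \<in> even_nodes t \<Longrightarrow> kids (subtree t p) = [] \<or>
    length (kids (subtree t p)) = k \<and> (\<exists>c\<in>set (kids (subtree t p)). kids c \<noteq> [])"
  shows "pruned_even_kary k t"
proof -
  let ?P = "\<lambda>t::'a otree. kids t = [] \<or> length (kids t) = k \<and> (\<exists>c\<in>set (kids t). kids c \<noteq> [])"
  have "even_kary k (unprune k True t) \<and> shape t = prune True (unprune k True t)"
    if "\<forall>p\<in>even_nodes t. ?P (subtree t p)" for t :: "'a otree"
    using that
  proof (induction t rule: otree_grandchild_induct)
    case (grandchild t)
    have "?P t" and gp: "\<And>c s. c \<in> set (kids t) \<Longrightarrow> s \<in> set (kids c) \<Longrightarrow> \<forall>p\<in>even_nodes s. ?P (subtree s p)"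
      using grandchild.prems by (subst (asm) ball_even_nodes, blast)+
    then have IH: "even_kary k (unprune k True s)" "shape s = prune True (unprune k True s)"
      if "c \<in> set (kids t)" "s \<in> set (kids c)" for c s
      using grandchild.IH that by blast+
    show ?case
    proof (cases "kids t = []")
      case True
      then show ?thesis
        by (cases t) (simp add: even_kary_unfold[of k "Node _ _"] shape_def)
    next
      case False
      then have len: "length (kids t) = k" and ex: "\<exists>c\<in>set (kids t). kids c \<noteq> []"
        using \<open>?P t\<close> by auto
      have "even_kary k (unprune k True t)"
        using False len IH(1) by (subst even_kary_unfold) (auto simp: kids_unprune_True kids_unprune_False)
      moreover have "shape c = prune False (unprune k False c)" if "c \<in> set (kids t)" for c
        using IH(2)[OF that] by (cases c) (simp add: shape_def)
      then have "kids (shape t) = kids (prune True (unprune k True t))"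
        using False ex by (auto simp: kids_shape kids_prune_True kids_unprune_True kids_unprune_False)
      then have "shape t = prune True (unprune k True t)"
        by (intro otree.expand) simp
      ultimately show ?thesis by blast
    qed
  qed
  then show ?thesis using assms unfolding pruned_even_kary_def by blast
qed

lemma pruned_even_kary_iff:
  "pruned_even_kary k t \<longleftrightarrow> (\<forall>p\<in>even_nodes t. kids (subtree t p) = [] \<or>
    length (kids (subtree t p)) = k \<and> (\<exists>c\<in>set (kids (subtree t p)). kids c \<noteq> []))"
  by (meson pruned_even_karyD pruned_even_karyI pruned_even_kary_def)

section \<open>The multiset of local data, and increasing trees in terms of it\<close>

text \<open>
  The data of an even-level node: its label, and for each of its children the label (\<^term>\<open>None\<close> in an
  increasing tree) and the labels of the grand children below it.
\<close>

type_synonym local_data = "nat option \<times> (nat option \<times> nat list) list"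

definition local_data :: "nat option otree \<Rightarrow> local_data" where
  "local_data t = (lab t, map (\<lambda>c. (lab c, map (\<lambda>s. the (lab s)) (kids c))) (kids t))"

text \<open>Multiplicities matter: they are what later encodes injectivity of the labeling.\<close>

definition family :: "nat option otree \<Rightarrow> local_data multiset" where
  "family t = (\<Sum>p\<in>even_nodes t. {#local_data (subtree t p)#})"

text \<open>Forgets under which child a grand child hangs; order conditions between generations, and
  old against young, depend on this set alone.\<close>

definition entries :: "local_data \<Rightarrow> nat set" where
  "entries r = (\<Union>c\<in>set (snd r). set (snd c))"

text \<open>Odd-level nodes add no term of their own: they are recorded in the data of their parent,
  so the recursion goes straight to the grand children.\<close>

lemma family_unfold:
  "family t = {#local_data t#} + (\<Sum>c\<leftarrow>kids t. \<Sum>s\<leftarrow>kids c. family s)"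
proof -
  let ?S = "SIGMA i:{..<length (kids t)}. SIGMA j:{..<length (kids (kids t ! i))}.
        even_nodes (kids (kids t ! i) ! j)"
  have "family t = {#local_data t#} +
      (\<Sum>(i, j, p)\<in>?S. {#local_data (subtree (kids (kids t ! i) ! j) p)#})"
    unfolding family_def
    by (subst even_nodes_unfold, subst sum.insert)
      (auto intro!: finite_SigmaI finite_imageI simp: sum.reindex inj_on_def case_prod_beta)
  also have "(\<Sum>(i, j, p)\<in>?S. {#local_data (subtree (kids (kids t ! i) ! j) p)#}) =
     (\<Sum>i<length (kids t). \<Sum>j<length (kids (kids t ! i)). family (kids (kids t ! i) ! j))"
    unfolding family_def
    by (simp add: sum.Sigma[symmetric] finite_SigmaI)
  also have "\<dots> = (\<Sum>c\<leftarrow>kids t. \<Sum>s\<leftarrow>kids c. family s)"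
    by (simp add: sum_list_sum_nth atLeast0LessThan)
  finally show ?thesis .
qed

lemma family_eq_image_mset:
  "family t = image_mset (\<lambda>p. local_data (subtree t p)) (mset_set (even_nodes t))"
proof -
  have "(\<Sum>p\<in>A. {#f p#}) = image_mset f (mset_set A)" if "finite A"
    for A and f :: "nat list \<Rightarrow> local_data"
    using that by (induction A) auto
  then show ?thesis by (simp add: family_def)
qed

lemma set_mset_family:
  "set_mset (family t) = (\<lambda>p. local_data (subtree t p)) ` even_nodes t"
  by (simp add: family_eq_image_mset)

lemma fst_local_data [simp]: "fst (local_data t) = lab t"
  by (simp add: local_data_def)

lemma snd_local_data_Nil_iff [simp]: "snd (local_data t) = [] \<longleftrightarrow> kids t = []"
  by (simp add: local_data_def)

lemma length_snd_local_data [simp]: "length (snd (local_data t)) = length (kids t)"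
  by (simp add: local_data_def)

lemma entries_local_data:
  "entries (local_data t) = (\<Union>c\<in>set (kids t). (\<lambda>s. the (lab s)) ` set (kids c))"
  by (auto simp: entries_def local_data_def)

lemma entries_local_data_subtree:
  assumes "p \<in> even_nodes t"
  shows "entries (local_data (subtree t p)) = {label t (p @ [i, j]) | i j. p @ [i, j] \<in> even_nodes t}"
  using assms
  by (auto simp: entries_local_data even_nodes_append Cons_Cons_even_nodes label_def subtree_append
      in_set_conv_nth image_iff) (metis nth_mem)+

text \<open>The local form of the conditions in \<open>inc_trees\<close> other than bijectivity. A
  nonempty set of entries says that some child has a child, so it is the pruning condition;
  \<open>None\<close> keeps odd levels unlabeled.\<close>

definition admissible :: "nat \<Rightarrow> local_data \<Rightarrow> bool" where
  "admissible k r \<longleftrightarrow>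
     (\<exists>a. fst r = Some a \<and> (\<forall>z\<in>entries r. a < z)) \<and>
     (snd r = [] \<or> length (snd r) = k \<and> entries r \<noteq> {}) \<and>
     (\<forall>c\<in>set (snd r). fst c = None \<and> sorted_wrt (<) (snd c))"

lemma image_mset_mset_set_eq_iff:
  assumes "finite A" "finite B"
  shows "image_mset f (mset_set A) = mset_set B \<longleftrightarrow> bij_betw f A B"
proof
  assume *: "image_mset f (mset_set A) = mset_set B"
  have "f ` A = B"
    using arg_cong[OF *, of set_mset] assms by simp
  moreover have "card A = card B"
    using arg_cong[OF *, of size] by simp
  ultimately show "bij_betw f A B"
    using assms by (auto simp: bij_betw_def intro: eq_card_imp_inj_on)
next
  assume "bij_betw f A B"
  then show "image_mset f (mset_set A) = mset_set B"
    by (auto simp: bij_betw_def image_mset_mset_set)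
qed

text \<open>Every element of \<open>mset_set\<close> has multiplicity one, so equality of the
  multisets expresses injectivity and surjectivity together.\<close>

lemma labels_family_eq_iff:
  assumes "finite M" "\<And>p. p \<in> even_nodes t \<Longrightarrow> lab (subtree t p) \<noteq> None"
  shows "image_mset fst (family t) = mset_set (Some ` M) \<longleftrightarrow> bij_betw (label t) (even_nodes t) M"
proof -
  have "image_mset fst (family t) = image_mset (\<lambda>p. Some (label t p)) (mset_set (even_nodes t))"
    using assms(2) by (auto simp: family_eq_image_mset label_def multiset.map_comp intro!: image_mset_cong)
  then have "image_mset fst (family t) = mset_set (Some ` M) \<longleftrightarrow>
      bij_betw (\<lambda>p. Some (label t p)) (even_nodes t) (Some ` M)"
    using assms(1) by (simp add: image_mset_mset_set_eq_iff)
  also have "\<dots> \<longleftrightarrow> bij_betw (label t) (even_nodes t) M"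
    by (simp add: bij_betw_def inj_on_def image_image[of Some "label t", symmetric] inj_image_eq_iff)
  finally show ?thesis .
qed

text \<open>Both ends lie on even levels, so the path between them splits into steps from grand
  parent to grand child, and each step is an inequality in some admissible datum.\<close>

lemma label_less_of_strict_prefix:
  assumes "\<And>r. r \<in># family t \<Longrightarrow> admissible k r"
    and "p \<in> even_nodes t" "p @ q \<in> even_nodes t" "q \<noteq> []"
  shows "label t p < label t (p @ q)"
  using assms(2-)
proof (induction "length q" arbitrary: p q rule: less_induct)
  case less
  have "even (length q)"
    using less.prems by (simp add: even_nodes_def)
  then obtain i j q' where q: "q = i # j # q'"
    using less.prems(3) by (cases q; cases "tl q") auto
  have pij: "p @ [i, j] \<in> even_nodes t"
    using less.prems by (auto simp: q even_nodes_append Cons_Cons_even_nodes)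
  have "label t (p @ [i, j]) \<in> entries (local_data (subtree t p))"
    using less.prems pij by (auto simp: entries_local_data_subtree)
  moreover have "admissible k (local_data (subtree t p))"
    using assms(1) less.prems by (auto simp: set_mset_family)
  ultimately have "label t p < label t (p @ [i, j])"
    by (auto simp: admissible_def label_def)
  moreover have "label t (p @ [i, j]) < label t ((p @ [i, j]) @ q')" if "q' \<noteq> []"
    using less.hyps[of q' "p @ [i, j]"] less.prems pij that by (simp add: q)
  ultimately show ?case by (cases "q' = []") (auto simp: q)
qed

lemma inc_trees_iff:
  assumes "finite M"
  shows "t \<in> inc_trees k M \<longleftrightarrow>
    (\<forall>r\<in>#family t. admissible k r) \<and> image_mset fst (family t) = mset_set (Some ` M)"
    (is "?L \<longleftrightarrow> ?R")
proof
  assume L: ?L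
  then have ln: "labeled_nodes t = even_nodes t"
    and bij: "bij_betw (label t) (even_nodes t) M"
    and pre: "\<And>p q. p \<in> even_nodes t \<Longrightarrow> q \<in> even_nodes t \<Longrightarrow> strict_prefix p q \<Longrightarrow> label t p < label t q"
    and row: "\<And>p i j. p \<in> nodes t \<Longrightarrow> i < j \<Longrightarrow> p @ [i] \<in> even_nodes t \<Longrightarrow> p @ [j] \<in> even_nodes t
        \<Longrightarrow> label t (p @ [i]) < label t (p @ [j])"
    and pr: "pruned_even_kary k t"
    by (auto simp: inc_trees_def even_nodes_def)
  have "admissible k (local_data (subtree t p))" if p: "p \<in> even_nodes t" for p
    unfolding admissible_def
  proof (intro conjI ballI)
    have "lab (subtree t p) = Some (label t p)"
      using p unfolding ln[symmetric] by (auto simp: labeled_nodes_def label_def)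
    moreover have "label t p < z" if "z \<in> entries (local_data (subtree t p))" for z
      using that p by (auto simp: entries_local_data_subtree strict_prefix_def intro!: pre)
    ultimately show "\<exists>a. fst (local_data (subtree t p)) = Some a \<and>
        (\<forall>z\<in>entries (local_data (subtree t p)). a < z)"
      by auto
    show "snd (local_data (subtree t p)) = [] \<or>
        length (snd (local_data (subtree t p))) = k \<and> entries (local_data (subtree t p)) \<noteq> {}"
      using pr p by (auto simp: pruned_even_kary_iff entries_local_data)
  next
    fix c assume "c \<in> set (snd (local_data (subtree t p)))"
    then obtain i where i: "i < length (kids (subtree t p))" and c: "c = snd (local_data (subtree t p)) ! i"
      by (auto simp: in_set_conv_nth)
    have "p @ [i] \<in> nodes t" "p @ [i] \<notin> even_nodes t"
      using p i by (auto simp: even_nodes_def nodes_def is_node_append)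
    then have "lab (subtree t (p @ [i])) = None"
      using ln by (auto simp: labeled_nodes_def)
    then show "fst c = None"
      using i by (simp add: c local_data_def subtree_append)
    show "sorted_wrt (<) (snd c)"
    proof -
      have "the (lab (kids (kids (subtree t p) ! i) ! m)) < the (lab (kids (kids (subtree t p) ! i) ! n))"
        if "m < n" "n < length (kids (kids (subtree t p) ! i))" for m n
        using row[OF \<open>p @ [i] \<in> nodes t\<close> \<open>m < n\<close>] p i that
        by (auto simp: even_nodes_append Cons_Cons_even_nodes label_def subtree_append)
      then show ?thesis
        using i by (simp add: c local_data_def sorted_wrt_iff_nth_less)
    qed
  qed
  moreover have "image_mset fst (family t) = mset_set (Some ` M)"
    using bij assms ln[symmetric] by (subst labels_family_eq_iff) (auto simp: labeled_nodes_def)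
  ultimately show ?R by (simp add: set_mset_family)
next
  assume R: ?R
  then have adm: "admissible k (local_data (subtree t p))" if "p \<in> even_nodes t" for p
    using that by (auto simp: set_mset_family)
  have lab_even: "lab (subtree t p) \<noteq> None" if "p \<in> even_nodes t" for p
    using adm[OF that] by (auto simp: admissible_def)
  have row: "lab (kids (subtree t p) ! i) = None"
    "sorted_wrt (<) (map (\<lambda>s. the (lab s)) (kids (kids (subtree t p) ! i)))"
    if "p \<in> even_nodes t" "i < length (kids (subtree t p))" for p i
  proof -
    have "snd (local_data (subtree t p)) ! i \<in> set (snd (local_data (subtree t p)))"
      using that by simp
    then have "fst (snd (local_data (subtree t p)) ! i) = None \<and>
        sorted_wrt (<) (snd (snd (local_data (subtree t p)) ! i))"
      using adm[OF that(1)] unfolding admissible_def by blast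
    then show "lab (kids (subtree t p) ! i) = None"
      "sorted_wrt (<) (map (\<lambda>s. the (lab s)) (kids (kids (subtree t p) ! i)))"
      using that by (auto simp: local_data_def)
  qed
  \<comment> \<open>Each odd-level node is a child of an even-level node, so the data of even-level
    nodes also control the labels on odd levels.\<close>
  have odd: "\<exists>q m. q \<in> even_nodes t \<and> m < length (kids (subtree t q)) \<and> p = q @ [m]"
    if "p \<in> nodes t" "odd (length p)" for p
    using that by (cases p rule: rev_cases) (auto simp: even_nodes_def nodes_def is_node_append)
  have ln: "labeled_nodes t = even_nodes t"
  proof (rule set_eqI)
    fix p
    show "p \<in> labeled_nodes t \<longleftrightarrow> p \<in> even_nodes t"
    proof (cases "p \<in> nodes t \<and> odd (length p)")
      case True
      then have "lab (subtree t p) = None"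
        using odd[of p] row(1) by (auto simp: subtree_append)
      then show ?thesis using True by (auto simp: labeled_nodes_def even_nodes_def)
    next
      case False
      then show ?thesis using lab_even[of p] by (auto simp: labeled_nodes_def even_nodes_def)
    qed
  qed
  have "bij_betw (label t) (even_nodes t) M"
    using R assms lab_even labels_family_eq_iff by blast
  moreover have "pruned_even_kary k t"
    using adm by (force simp: pruned_even_kary_iff admissible_def entries_local_data)
  moreover have "label t p < label t q"
    if "p \<in> even_nodes t" "q \<in> even_nodes t" "strict_prefix p q" for p q
  proof -
    obtain r where "q = p @ r" "r \<noteq> []"
      using \<open>strict_prefix p q\<close> by (auto simp: strict_prefix_def prefix_def)
    then show ?thesis
      using that(1,2) R label_less_of_strict_prefix[of t k p r] by blast
  qed
  moreover have "label t (p @ [i]) < label t (p @ [j])"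
    if "p \<in> nodes t" "i < j" "p @ [i] \<in> even_nodes t" "p @ [j] \<in> even_nodes t" for p i j
  proof -
    have "odd (length p)"
      using that(3) by (simp add: even_nodes_def)
    then obtain q m where q: "q \<in> even_nodes t" "m < length (kids (subtree t q))" and p: "p = q @ [m]"
      using odd[of p] \<open>p \<in> nodes t\<close> by blast
    have "j < length (kids (kids (subtree t q) ! m))"
      using that(4) q by (simp add: p even_nodes_append Cons_Cons_even_nodes)
    then show ?thesis
      using row(2)[OF q] \<open>i < j\<close>
      by (simp add: p label_def subtree_append sorted_wrt_iff_nth_less)
  qed
  ultimately show ?L
    using ln unfolding inc_trees_def even_nodes_def[symmetric] by simp
qed

section \<open>How replacing a subtree, and each of the two moves, changes the multiset\<close>

lemma sum_list_map_update:
  fixes f :: "'a \<Rightarrow> 'b::comm_monoid_add"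
  shows "i < length xs \<Longrightarrow>
    sum_list (map f (xs[i := y])) + f (xs ! i) = sum_list (map f xs) + f y"
proof (induction xs arbitrary: i)
  case (Cons a xs)
  show ?case
  proof (cases i)
    case (Suc j)
    then show ?thesis using Cons.IH[of j] Cons.prems by (simp add: add.assoc)
  qed (simp add: ac_simps)
qed simp

lemma map_list_update_same:
  "i < length xs \<Longrightarrow> f y = f (xs ! i) \<Longrightarrow> map f (xs[i := y]) = map f xs"
  by (metis list_update_id map_update)

lemma filter_list_update_irrelevant:
  "i < length xs \<Longrightarrow> \<not> P y \<Longrightarrow> \<not> P (xs ! i) \<Longrightarrow> filter P (xs[i := y]) = filter P xs"
proof (induction xs arbitrary: i)
  case (Cons a xs)
  then show ?case by (cases i) auto
qed simp

lemma sum_list_map_filter_compl: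
  fixes f :: "'a \<Rightarrow> 'b::comm_monoid_add"
  shows "sum_list (map f xs) =
    sum_list (map f (filter P xs)) + sum_list (map f (filter (\<lambda>z. \<not> P z) xs))"
  by (induction xs) (auto simp: ac_simps)

lemma sum_list_map_sort_key:
  fixes f :: "'a \<Rightarrow> 'b::comm_monoid_add"
  shows "sum_list (map f (sort_key g xs)) = sum_list (map f xs)"
  by (metis mset_map mset_sort sum_mset_sum_list)

lemma map_sort_key: "map f (sort_key f xs) = sort (map f xs)"
  by (rule properties_for_sort[symmetric]) simp_all

lemma local_data_replace_at:
  assumes "i # j # q \<in> even_nodes t" "lab s = lab (subtree t (i # j # q))"
  shows "local_data (replace_at t (i # j # q) s) = local_data t"
  using assms
  by (auto simp: local_data_def Cons_Cons_even_nodes lab_replace_at intro!: map_list_update_same)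

text \<open>A datum sees of a grand child only its label, so nodes above the replaced subtree keep
  their data. The equation is additive because subtraction of multisets truncates.\<close>

lemma family_replace_at:
  assumes "p \<in> even_nodes t" "lab s = lab (subtree t p)"
  shows "family (replace_at t p s) + family (subtree t p) = family t + family s"
  using assms
proof (induction p arbitrary: t rule: induct_list012)
  case 1
  then show ?case by simp
next
  case (2 i)
  then show ?case by (simp add: even_nodes_def)
next
  case (3 i j q)
  define c where "c = kids t ! i"
  define g where "g = kids c ! j"
  define g' where "g' = replace_at g q s"
  define c' where "c' = Node (lab c) ((kids c)[j := g'])"
  define F where "F c = (\<Sum>s\<leftarrow>kids c. family s)" for c
  have ij: "i < length (kids t)" "j < length (kids c)" "q \<in> even_nodes g"
    using 3(3) by (auto simp: Cons_Cons_even_nodes c_def g_def)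
  have t': "replace_at t (i # j # q) s = Node (lab t) ((kids t)[i := c'])"
    by (simp add: c'_def g'_def g_def c_def)
  have IH: "family g' + family (subtree g q) = family g + family s"
    using 3(1)[of g] 3(4) ij by (simp add: g'_def g_def c_def)
  have Fc: "F c' + family g = F c + family g'"
    using sum_list_map_update[OF ij(2), of family g'] by (simp add: F_def c'_def g_def)
  have Ft: "sum_list (map F ((kids t)[i := c'])) + F c = sum_list (map F (kids t)) + F c'"
    using sum_list_map_update[OF ij(1), of F c'] by (simp add: c_def)
  have "sum_list (map F ((kids t)[i := c'])) + family (subtree g q) = sum_list (map F (kids t)) + family s"
  \<comment> \<open>Passing to the count of each element turns the equations into linear ones over
    the naturals, where common terms cancel by arithmetic.\<close>
  proof (rule multiset_eqI)
    fix z show "count (sum_list (map F ((kids t)[i := c'])) + family (subtree g q)) z =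
        count (sum_list (map F (kids t)) + family s) z"
      using arg_cong[OF IH, of "\<lambda>m. count m z"] arg_cong[OF Fc, of "\<lambda>m. count m z"]
        arg_cong[OF Ft, of "\<lambda>m. count m z"]
      by simp
  qed
  moreover have "family (replace_at t (i # j # q) s) =
      {#local_data t#} + sum_list (map F ((kids t)[i := c']))"
    using local_data_replace_at[OF 3(3,4)]
    by (subst family_unfold) (simp add: t' F_def[abs_def] del: replace_at.simps)
  moreover have "family t = {#local_data t#} + sum_list (map F (kids t))"
    by (subst family_unfold) (simp add: F_def[abs_def])
  ultimately show ?case by (simp add: g_def c_def)
qed

definition merge_data :: "local_data \<Rightarrow> local_data \<Rightarrow> local_data" where
  "merge_data r r' = (fst r, map2 (\<lambda>c d. (fst c, sort (snd c @ snd d))) (snd r) (snd r'))"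

definition lower_data :: "nat \<Rightarrow> local_data \<Rightarrow> local_data" where
  "lower_data x r = (fst r, map (\<lambda>c. (fst c, filter (\<lambda>z. \<not> x < z) (snd c))) (snd r))"

definition upper_data :: "nat \<Rightarrow> local_data \<Rightarrow> local_data" where
  "upper_data x r = (Some x, map (\<lambda>c. (None, sort (filter (\<lambda>z. x < z) (snd c)))) (snd r))"

text \<open>Deleting the children of v leaves a childless datum at v and does not touch the datum of
  u; the families that hung below them reappear below u. When the balances are added, everything but
  the data of u and v cancels.\<close>

lemma family_merge_up:
  assumes v: "u @ [i, j] \<in> even_nodes t"
    and len: "length (kids (subtree t u)) = length (kids (subtree t (u @ [i, j])))"
  shows "family (merge_up t (u @ [i, j])) +
      {#local_data (subtree t u), local_data (subtree t (u @ [i, j]))#} =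
    family t + {#merge_data (local_data (subtree t u)) (local_data (subtree t (u @ [i, j]))),
      (lab (subtree t (u @ [i, j])), [])#}"
proof -
  define U where "U = subtree t u"
  define V where "V = subtree t (u @ [i, j])"
  define V0 where "V0 = Node (lab V) []"
  define U0 where "U0 = replace_at U [i, j] V0"
  define h where "h \<mu> \<nu> = Node (lab \<mu>) (sort_by_label (kids \<mu> @ kids \<nu>))" for \<mu> \<nu>
  define U' where "U' = Node (lab U0) (map2 h (kids U0) (kids V))"
  define F where "F c = (\<Sum>s\<leftarrow>kids c. family s)" for c
  have u: "u \<in> even_nodes t"
    using v by (auto simp: even_nodes_def nodes_def is_node_append)
  have ij: "[i, j] \<in> even_nodes U" and V: "V = subtree U [i, j]"
    using v u by (auto simp: even_nodes_append U_def V_def subtree_append)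
  have "merge_up t (u @ [i, j]) = replace_at t u U'"
    using u unfolding merge_up_def Let_def
    by (simp add: grandparent_def butlast_append even_nodes_def nodes_def
        subtree_replace_at_append U'_def h_def U0_def V0_def V_def U_def del: replace_at.simps)
  moreover have "lab U' = lab (subtree t u)"
    using V by (simp add: U'_def U0_def U_def)
  ultimately have 1: "family (merge_up t (u @ [i, j])) + family U = family t + family U'"
    using family_replace_at[OF u, of U'] by (simp add: U_def)
  have 2: "family U0 + family V = family U + family V0"
    using family_replace_at[OF ij, of V0] V by (simp add: U0_def V0_def)
  have ld: "local_data U0 = local_data U"
    using local_data_replace_at[OF ij, of V0] V by (simp add: U0_def V0_def)
  have len0: "length (kids U0) = length (kids V)"
    using len by (simp add: U0_def U_def V_def)
  \<comment> \<open>Sorting only permutes the subtrees, so a sum over them ignores it.\<close>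
  have Fh: "F (h \<mu> \<nu>) = F \<mu> + F \<nu>" for \<mu> \<nu>
    by (simp add: F_def h_def sort_by_label_def sum_list_map_sort_key)
  have "sum_list (map F (map2 h cs ds)) = sum_list (map F cs) + sum_list (map F ds)"
    if "length cs = length ds" for cs ds
    using that by (induction cs ds rule: list_induct2) (simp_all add: Fh ac_simps)
  then have "sum_list (map F (map2 h (kids U0) (kids V))) =
      sum_list (map F (kids U0)) + sum_list (map F (kids V))"
    using len0 .
  then have 3: "family U' = {#local_data U'#} + sum_list (map F (kids U0)) + sum_list (map F (kids V))"
    by (subst family_unfold) (simp add: U'_def F_def[abs_def])
  have 4: "family U0 = {#local_data U#} + sum_list (map F (kids U0))"
    "family V = {#local_data V#} + sum_list (map F (kids V))"
    by (subst family_unfold, simp add: F_def[abs_def] ld)+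
  have 5: "family V0 = {#(lab V, [])#}"
    by (subst family_unfold) (simp add: V0_def local_data_def)
  have 6: "local_data U' = merge_data (local_data U) (local_data V)"
    unfolding ld[symmetric]
    by (simp add: U'_def merge_data_def local_data_def h_def zip_map_map sort_by_label_def
        map_sort_key case_prod_beta)
  show ?thesis
    unfolding U_def[symmetric] V_def[symmetric] 6[symmetric]
  proof (rule multiset_eqI)
    fix z
    show "count (family (merge_up t (u @ [i, j])) + {#local_data U, local_data V#}) z =
      count (family t + {#local_data U', (lab V, [])#}) z"
      using arg_cong[OF 1, of "\<lambda>m. count m z"] arg_cong[OF 2, of "\<lambda>m. count m z"]
        arg_cong[OF 3, of "\<lambda>m. count m z"] arg_cong[OF 4(1), of "\<lambda>m. count m z"]
        arg_cong[OF 4(2), of "\<lambda>m. count m z"] arg_cong[OF 5, of "\<lambda>m. count m z"]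
      by (simp split: if_splits)
  qed
qed

lemma family_split_down:
  assumes v: "u @ [i, j] \<in> even_nodes t"
    and leaf: "kids (subtree t (u @ [i, j])) = []"
    and x: "lab (subtree t (u @ [i, j])) = Some x"
  shows "family (split_down t (u @ [i, j])) + {#local_data (subtree t u), (Some x, [])#} =
    family t + {#lower_data x (local_data (subtree t u)), upper_data x (local_data (subtree t u))#}"
proof -
  define U where "U = subtree t u"
  define V where "V = subtree t (u @ [i, j])"
  define hi where "hi s \<longleftrightarrow> x < the (lab s)" for s :: "nat option otree"
  define V' where "V' = Node (Some x) (map (\<lambda>\<mu>. Node None (sort_by_label (filter hi (kids \<mu>)))) (kids U))"
  define U0 where "U0 = replace_at U [i, j] V'"
  define U' where "U' = Node (lab U0) (map (\<lambda>\<mu>. Node (lab \<mu>) (filter (\<lambda>s. \<not> hi s) (kids \<mu>))) (kids U0))"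
  define G where "G c = (\<Sum>s\<leftarrow>filter hi (kids c). family s)" for c
  define H where "H c = (\<Sum>s\<leftarrow>filter (\<lambda>s. \<not> hi s) (kids c). family s)" for c
  have u: "u \<in> even_nodes t"
    using v by (auto simp: even_nodes_def nodes_def is_node_append)
  have ij: "[i, j] \<in> even_nodes U" and V: "V = subtree U [i, j]"
    using v u by (auto simp: even_nodes_append U_def V_def subtree_append)
  then have ij': "i < length (kids U)" "j < length (kids (kids U ! i))" and V2: "V = kids (kids U ! i) ! j"
    by (auto simp: Cons_Cons_even_nodes)
  have labV: "lab V = Some x" "kids V = []"
    using x leaf by (auto simp: V_def)
  have "split_down t (u @ [i, j]) = replace_at t u U'"
    using u x unfolding split_down_def Let_def
    by (simp add: grandparent_def butlast_append even_nodes_def nodes_def label_def hi_def[abs_def]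
        subtree_replace_at_append U'_def U0_def V'_def V_def U_def del: replace_at.simps)
  moreover have "lab U' = lab (subtree t u)"
    using V by (simp add: U'_def U0_def U_def)
  ultimately have 1: "family (split_down t (u @ [i, j])) + family U = family t + family U'"
    using family_replace_at[OF u, of U'] by (simp add: U_def)
  have 2: "family U0 + family V = family U + family V'"
    using family_replace_at[OF ij, of V'] V labV by (simp add: U0_def V'_def)
  have ld: "local_data U0 = local_data U"
    using local_data_replace_at[OF ij, of V'] V labV by (simp add: U0_def V'_def)
  \<comment> \<open>The new children of v are filled from the rows before v is replaced, while the
    removal acts on the rows afterwards. Both see the same moved subtrees, because v carries x
    itself and x is not greater than x.\<close>
  have "\<not> hi V" "\<not> hi V'"
    using labV by (auto simp: hi_def V'_def)
  then have "map G (kids U0) = map G (kids U)"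
    using ij' V2 by (auto simp: U0_def G_def intro!: map_list_update_same)
      (simp add: filter_list_update_irrelevant)
  moreover have "(\<Sum>s\<leftarrow>kids c. family s) = G c + H c" for c
    unfolding G_def H_def by (rule sum_list_map_filter_compl)
  ultimately have "(\<Sum>c\<leftarrow>kids U0. \<Sum>s\<leftarrow>kids c. family s) =
      sum_list (map G (kids U)) + sum_list (map H (kids U0))"
    by (simp add: sum_list_addf)
  then have 3: "family U0 = {#local_data U#} + sum_list (map G (kids U)) + sum_list (map H (kids U0))"
    by (subst family_unfold) (simp add: ld)
  have 4: "family V' = {#local_data V'#} + sum_list (map G (kids U))"
    by (subst family_unfold)
      (simp add: V'_def G_def[abs_def] sort_by_label_def sum_list_map_sort_key o_def)
  have 5: "family V = {#(Some x, [])#}"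
    using labV by (subst family_unfold) (simp add: local_data_def)
  have 6: "family U' = {#local_data U'#} + sum_list (map H (kids U0))"
    by (subst family_unfold) (simp add: U'_def H_def[abs_def] o_def)
  have 7: "local_data U' = lower_data x (local_data U)"
    unfolding ld[symmetric]
    by (simp add: U'_def lower_data_def local_data_def hi_def filter_map o_def)
  have 8: "local_data V' = upper_data x (local_data U)"
    by (simp add: V'_def upper_data_def local_data_def hi_def[abs_def] filter_map o_def sort_by_label_def
        map_sort_key)
  show ?thesis
    unfolding U_def[symmetric] 7[symmetric] 8[symmetric]
  proof (rule multiset_eqI)
    fix z
    show "count (family (split_down t (u @ [i, j])) + {#local_data U, (Some x, [])#}) z =
      count (family t + {#local_data U', local_data V'#}) z"
      using arg_cong[OF 1, of "\<lambda>m. count m z"] arg_cong[OF 2, of "\<lambda>m. count m z"]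
        arg_cong[OF 3, of "\<lambda>m. count m z"] arg_cong[OF 4, of "\<lambda>m. count m z"]
        arg_cong[OF 5, of "\<lambda>m. count m z"] arg_cong[OF 6, of "\<lambda>m. count m z"]
      by (simp split: if_splits)
  qed
qed

section \<open>Node types read off from the multiset\<close>

lemma grandparent_append [simp]: "grandparent (u @ [i, j]) = u"
  by (simp add: grandparent_def butlast_append)

text \<open>A locale because \<open>types_of_merge\<close> interprets it twice, for the trees on
  both sides of a move.\<close>

locale inc_tree =
  fixes k :: nat and M :: "nat set" and t :: "nat option otree"
  assumes finite_labels: "finite M" and inc: "t \<in> inc_trees k M"
begin

lemma labeled_nodes_eq: "labeled_nodes t = even_nodes t"
  using inc by (simp add: inc_trees_def even_nodes_def)

lemma bij_label: "bij_betw (label t) (even_nodes t) M"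
  using inc unfolding labeled_nodes_eq[symmetric] unfolding inc_trees_def by blast

lemma lab_subtree: "p \<in> even_nodes t \<Longrightarrow> lab (subtree t p) = Some (label t p)"
  unfolding labeled_nodes_eq[symmetric] by (auto simp: labeled_nodes_def label_def)

lemma admissible_local_data: "p \<in> even_nodes t \<Longrightarrow> admissible k (local_data (subtree t p))"
  using inc finite_labels by (auto simp: inc_trees_iff set_mset_family)

lemma node_of_label:
  assumes "p \<in> even_nodes t"
  shows "node_of t (label t p) = p"
  unfolding node_of_def labeled_nodes_eq
  using assms bij_label by (intro the_equality) (auto simp: bij_betw_def inj_on_def)

lemma node_of:
  assumes "y \<in> M"
  shows "node_of t y \<in> even_nodes t" "label t (node_of t y) = y"
proof -
  obtain p where p: "p \<in> even_nodes t" "label t p = y"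
    using assms bij_label by (auto simp: bij_betw_def)
  then have "node_of t y = p"
    using node_of_label by blast
  with p show "node_of t y \<in> even_nodes t" "label t (node_of t y) = y"
    by auto
qed

lemma even_node_nonrootE:
  assumes "p \<in> even_nodes t" "p \<noteq> []"
  obtains u i j where "p = u @ [i, j]" "u \<in> even_nodes t"
proof -
  have "even (length p)" using assms by (simp add: even_nodes_def)
  then obtain u i j where p: "p = u @ [i, j]"
    using assms(2) by (cases p rule: rev_cases; cases "butlast p" rule: rev_cases) auto
  moreover have "u \<in> even_nodes t"
    using assms(1) by (auto simp: p even_nodes_def nodes_def is_node_append)
  ultimately show thesis using that by blast
qed

lemma label_grandchildren:
  "u \<in> even_nodes t \<Longrightarrow> label t ` grandchildren t u = entries (local_data (subtree t u))"
  by (auto simp: entries_local_data_subtree grandchildren_def labeled_nodes_eq)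

text \<open>Labels are injective, so a datum with first component \<open>Some y\<close> can only
  come from the node labeled y; an existential statement about the multiset therefore
  suffices.\<close>

lemma is_leaf_iff:
  assumes "y \<in> M"
  shows "is_leaf t (node_of t y) \<longleftrightarrow> (\<exists>r\<in>#family t. fst r = Some y \<and> snd r = [])"
proof -
  have "is_leaf t (node_of t y) \<longleftrightarrow> (\<exists>p\<in>even_nodes t. label t p = y \<and> kids (subtree t p) = [])"
    using node_of[OF assms] node_of_label by (auto simp: is_leaf_def even_nodes_def)
  then show ?thesis
    by (auto simp: set_mset_family lab_subtree)
qed

lemma is_internal_iff:
  assumes "y \<in> M"
  shows "is_internal t (node_of t y) \<longleftrightarrow> (\<exists>r\<in>#family t. fst r = Some y \<and> snd r \<noteq> [])"
proof -
  have "is_internal t (node_of t y) \<longleftrightarrow> (\<exists>p\<in>even_nodes t. label t p = y \<and> kids (subtree t p) \<noteq> [])"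
    using node_of[OF assms] node_of_label by (auto simp: is_internal_def even_nodes_def)
  then show ?thesis
    by (auto simp: set_mset_family lab_subtree)
qed

lemma is_old_append_iff:
  assumes "u @ [i, j] \<in> even_nodes t" "u \<in> even_nodes t"
  shows "is_old t (u @ [i, j]) \<longleftrightarrow>
    (\<forall>z\<in>entries (local_data (subtree t u)). z \<le> label t (u @ [i, j]))"
  using assms by (simp add: is_old_def labeled_nodes_eq flip: label_grandchildren)

text \<open>By injectivity y is an entry only in the datum of its grand parent, and the root label
  is an entry nowhere. Leaving \<open>P\<close> open covers old and young at once.\<close>

lemma nonroot_iff:
  assumes "y \<in> M"
  shows "node_of t y \<noteq> [] \<and> P (entries (local_data (subtree t (grandparent (node_of t y))))) \<longleftrightarrow>
    (\<exists>r\<in>#family t. y \<in> entries r \<and> P (entries r))" (is "?L \<longleftrightarrow> ?R")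
proof
  assume ?L
  then obtain u i j where uij: "node_of t y = u @ [i, j]" "u \<in> even_nodes t"
    using even_node_nonrootE node_of(1)[OF assms] by metis
  then have "y \<in> entries (local_data (subtree t u))"
    using node_of[OF assms] by (auto simp: entries_local_data_subtree)
  with uij \<open>?L\<close> show ?R by (auto simp: set_mset_family)
next
  assume ?R
  then obtain u where u: "u \<in> even_nodes t" "y \<in> entries (local_data (subtree t u))"
    "P (entries (local_data (subtree t u)))"
    by (auto simp: set_mset_family)
  then obtain i j where "y = label t (u @ [i, j])" "u @ [i, j] \<in> even_nodes t"
    by (auto simp: entries_local_data_subtree)
  then have "node_of t y = u @ [i, j]"
    using node_of_label by blast
  with u show ?L by simp
qed

lemma is_old_iff:
  assumes "y \<in> M"
  shows "is_old t (node_of t y) \<longleftrightarrow> (\<exists>r\<in>#family t. y \<in> entries r \<and> (\<forall>z\<in>entries r. z \<le> y))"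
proof -
  have "is_old t (node_of t y) \<longleftrightarrow> node_of t y \<noteq> [] \<and>
      (\<forall>z\<in>entries (local_data (subtree t (grandparent (node_of t y)))). z \<le> y)"
    using node_of[OF assms] is_old_append_iff
    by (cases "node_of t y = []") (simp add: is_old_def, metis even_node_nonrootE grandparent_append)
  then show ?thesis
    by (simp add: nonroot_iff[OF assms, of "\<lambda>E. \<forall>z\<in>E. z \<le> y"])
qed

text \<open>Not just the negation of \<open>is_old_iff\<close>: membership of y among the entries is
  kept, since the root is neither old nor young.\<close>

lemma is_young_iff:
  assumes "y \<in> M"
  shows "is_young t (node_of t y) \<longleftrightarrow> (\<exists>r\<in>#family t. y \<in> entries r \<and> (\<exists>z\<in>entries r. y < z))"
proof -
  have "is_young t (node_of t y) \<longleftrightarrow> node_of t y \<noteq> [] \<and>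
      (\<exists>z\<in>entries (local_data (subtree t (grandparent (node_of t y)))). y < z)"
    using node_of[OF assms] is_old_append_iff
    by (cases "node_of t y = []")
      (simp add: is_young_def, metis even_node_nonrootE grandparent_append is_young_def
        labeled_nodes_eq not_le)
  then show ?thesis
    by (simp add: nonroot_iff[OF assms, of "\<lambda>E. \<exists>z\<in>E. y < z"])
qed

end

text \<open>
  \<open>A\<close> and \<open>B\<close> are the data of the grand parent of \<open>x\<close> and of \<open>x\<close> itself when \<open>x\<close> is an old internal
  node, and \<open>C\<close> is the data of the grand parent when \<open>x\<close> is a young leaf. Applied with
  \<open>t' = Phi x t\<close> in case (i) and with \<open>t = Phi x t'\<close> in case (ii).
\<close>

lemma types_of_merge:
  assumes fin: "finite M" and t: "t \<in> inc_trees k M" and t': "t' \<in> inc_trees k M" and x: "x \<in> M"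
    and fam: "family t = N + {#A, B#}" and fam': "family t' = N + {#C, (Some x, [])#}"
    and labs: "fst C = fst A" "fst B = Some x"
    and C: "entries C = entries A \<union> entries B"
    and xA: "x \<in> entries A" and A_le: "\<And>z. z \<in> entries A \<Longrightarrow> z \<le> x"
    and B_gt: "\<And>z. z \<in> entries B \<Longrightarrow> x < z" and B: "entries B \<noteq> {}"
  shows "is_old t (node_of t x) \<and> is_internal t (node_of t x)"
    and "is_young t' (node_of t' x) \<and> is_leaf t' (node_of t' x)"
    and "\<forall>y\<in>M. y \<noteq> x \<longrightarrow>
      (is_old t' (node_of t' y) \<longleftrightarrow> is_old t (node_of t y)) \<and>
      (is_young t' (node_of t' y) \<longleftrightarrow> is_young t (node_of t y)) \<and>
      (is_leaf t' (node_of t' y) \<longleftrightarrow> is_leaf t (node_of t y)) \<and>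
      (is_internal t' (node_of t' y) \<longleftrightarrow> is_internal t (node_of t y))"
proof -
  interpret T: inc_tree k M t using fin t by unfold_locales
  interpret T': inc_tree k M t' using fin t' by unfold_locales
  have ne: "snd A \<noteq> []" "snd B \<noteq> []" "snd C \<noteq> []"
    using xA B C by (auto simp: entries_def)
  have e0: "entries (Some x, []) = {}"
    by (simp add: entries_def)
  show "is_old t (node_of t x) \<and> is_internal t (node_of t x)"
    using xA A_le ne labs by (auto simp: T.is_old_iff[OF x] T.is_internal_iff[OF x] fam)
  show "is_young t' (node_of t' x) \<and> is_leaf t' (node_of t' x)"
    using xA C B B_gt by (auto simp: T'.is_young_iff[OF x] T'.is_leaf_iff[OF x] fam')
  show "\<forall>y\<in>M. y \<noteq> x \<longrightarrow>
      (is_old t' (node_of t' y) \<longleftrightarrow> is_old t (node_of t y)) \<and>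
      (is_young t' (node_of t' y) \<longleftrightarrow> is_young t (node_of t y)) \<and>
      (is_leaf t' (node_of t' y) \<longleftrightarrow> is_leaf t (node_of t y)) \<and>
      (is_internal t' (node_of t' y) \<longleftrightarrow> is_internal t (node_of t y))"
  proof (intro ballI impI conjI)
    fix y assume y: "y \<in> M" "y \<noteq> x"
    \<comment> \<open>Some entry of \<open>B\<close> exceeds x and hence all of \<open>A\<close>, so
      a maximum of the union lies in \<open>B\<close>.\<close>
    have "y \<in> entries A \<union> entries B \<and> (\<forall>z\<in>entries A \<union> entries B. z \<le> y) \<longleftrightarrow> y \<in> entries B \<and> (\<forall>z\<in>entries B. z \<le> y)"
      using y A_le B_gt B by (meson UnCI UnE ex_in_conv leD le_less_trans less_imp_le linorder_le_cases)
    moreover have "\<not> (y \<in> entries A \<and> (\<forall>z\<in>entries A. z \<le> y))"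
      using y xA A_le by (meson le_antisym)
    ultimately show "is_old t' (node_of t' y) \<longleftrightarrow> is_old t (node_of t y)"
      by (simp add: T.is_old_iff[OF y(1)] T'.is_old_iff[OF y(1)] fam fam' C e0) blast
    \<comment> \<open>An entry of \<open>A\<close> other than x is below x, so it is young on both
      sides; an entry of \<open>B\<close> can be exceeded only by another entry of
      \<open>B\<close>.\<close>
    have "y \<in> entries A \<union> entries B \<and> (\<exists>z\<in>entries A \<union> entries B. y < z) \<longleftrightarrow>
        y \<in> entries A \<and> (\<exists>z\<in>entries A. y < z) \<or> y \<in> entries B \<and> (\<exists>z\<in>entries B. y < z)"
    proof (cases "y \<in> entries A")
      case True
      then have "y < x" using A_le y by (simp add: order_less_le)
      then show ?thesis using True xA by blast
    next
      case False
      then show ?thesis using A_le B_gt by fastforce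
    qed
    then show "is_young t' (node_of t' y) \<longleftrightarrow> is_young t (node_of t y)"
      by (simp add: T.is_young_iff[OF y(1)] T'.is_young_iff[OF y(1)] fam fam' C e0)
    show "is_leaf t' (node_of t' y) \<longleftrightarrow> is_leaf t (node_of t y)"
      using y ne labs by (simp add: T.is_leaf_iff[OF y(1)] T'.is_leaf_iff[OF y(1)] fam fam')
    show "is_internal t' (node_of t' y) \<longleftrightarrow> is_internal t (node_of t y)"
      using y ne labs by (simp add: T.is_internal_iff[OF y(1)] T'.is_internal_iff[OF y(1)] fam fam')
  qed
qed

section \<open>Admissibility of the exchanged data\<close>

lemma fst_merge_data [simp]: "fst (merge_data r r') = fst r"
  by (simp add: merge_data_def)

lemma fst_lower_data [simp]: "fst (lower_data x r) = fst r"
  by (simp add: lower_data_def)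

lemma fst_upper_data [simp]: "fst (upper_data x r) = Some x"
  by (simp add: upper_data_def)

lemma entries_merge_data:
  assumes "length (snd r) = length (snd r')"
  shows "entries (merge_data r r') = entries r \<union> entries r'"
proof -
  have "(\<Union>c\<in>set (map2 (\<lambda>c d. (fst c, sort (snd c @ snd d))) cs ds). set (snd c)) =
      (\<Union>c\<in>set cs. set (snd c)) \<union> (\<Union>c\<in>set ds. set (snd c))"
    if "length cs = length ds" for cs ds :: "(nat option \<times> nat list) list"
    using that by (induction cs ds rule: list_induct2) auto
  then show ?thesis
    using assms by (simp add: entries_def merge_data_def)
qed

lemma entries_lower_data: "entries (lower_data x r) = {z \<in> entries r. z \<le> x}"
  by (auto simp: entries_def lower_data_def)

lemma entries_upper_data: "entries (upper_data x r) = {z \<in> entries r. x < z}"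
  by (auto simp: entries_def upper_data_def)

lemma admissible_merge_data:
  assumes r: "admissible k r" and r': "admissible k r'"
    and x: "fst r' = Some x" "x \<in> entries r" and max: "\<And>z. z \<in> entries r \<Longrightarrow> z \<le> x"
    and len: "length (snd r) = length (snd r')"
  shows "admissible k (merge_data r r')"
  unfolding admissible_def
proof (intro conjI ballI)
  have gt: "x < z" if "z \<in> entries r'" for z
    using r' x that by (auto simp: admissible_def)
  obtain a where a: "fst r = Some a" "\<And>z. z \<in> entries r \<Longrightarrow> a < z"
    using r by (auto simp: admissible_def)
  then show "\<exists>a. fst (merge_data r r') = Some a \<and> (\<forall>z\<in>entries (merge_data r r'). a < z)"
    using x gt by (fastforce simp: entries_merge_data[OF len])
  have "snd r \<noteq> []" using x by (auto simp: entries_def)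
  then have "length (snd r) = k" using r by (auto simp: admissible_def)
  then have "length (snd (merge_data r r')) = k" using len by (simp add: merge_data_def)
  then show "snd (merge_data r r') = [] \<or>
      length (snd (merge_data r r')) = k \<and> entries (merge_data r r') \<noteq> {}"
    using x by (auto simp: entries_merge_data[OF len])
  fix c assume "c \<in> set (snd (merge_data r r'))"
  then obtain d e where c: "c = (fst d, sort (snd d @ snd e))"
    and zip: "(d, e) \<in> set (zip (snd r) (snd r'))"
    unfolding merge_data_def by force
  have de: "d \<in> set (snd r)" "e \<in> set (snd r')"
    using set_zip_leftD[OF zip] set_zip_rightD[OF zip] by auto
  show "fst c = None"
    using de r by (simp add: c admissible_def)
  have "sorted_wrt (<) (snd d)" "sorted_wrt (<) (snd e)"
    using de r r' by (auto simp: admissible_def)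
  \<comment> \<open>Sorting a concatenation gives only weak order; x separates the two rows, so no
    label repeats and the order is strict.\<close>
  moreover have "set (snd d) \<inter> set (snd e) = {}"
    using max gt de by (fastforce simp: entries_def)
  ultimately show "sorted_wrt (<) (snd c)"
    by (simp add: c strict_sorted_iff)
qed

text \<open>The entry x survives the filter, so the grand parent still has a grand child and the
  pruning condition holds.\<close>

lemma admissible_lower_data:
  assumes "admissible k r" "x \<in> entries r"
  shows "admissible k (lower_data x r)"
proof -
  have "snd r \<noteq> []" using assms by (auto simp: entries_def)
  moreover have "length (snd (lower_data x r)) = length (snd r)"
    by (simp add: lower_data_def)
  moreover have "fst c = None \<and> sorted_wrt (<) (snd c)" if "c \<in> set (snd (lower_data x r))" for c
    using that assms(1) by (auto simp: lower_data_def admissible_def sorted_wrt_filter)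
  ultimately show ?thesis
    using assms by (auto simp: admissible_def entries_lower_data)
qed

text \<open>The witness z, which exists because x is young, is moved below x; so the new children
  are not all leaves.\<close>

lemma admissible_upper_data:
  assumes "admissible k r" "z \<in> entries r" "x < z"
  shows "admissible k (upper_data x r)"
proof -
  have "snd r \<noteq> []" using assms by (auto simp: entries_def)
  moreover have "length (snd (upper_data x r)) = length (snd r)"
    by (simp add: upper_data_def)
  moreover have "fst c = None \<and> sorted_wrt (<) (snd c)" if "c \<in> set (snd (upper_data x r))" for c
    using that assms(1) by (auto simp: upper_data_def admissible_def strict_sorted_iff)
  ultimately show ?thesis
    using assms by (auto simp: admissible_def entries_upper_data)
qed

text \<open>Replacing two data by admissible ones with the same labels preserves both sides of
  \<open>inc_trees_iff\<close>. The data must differ so that two separate occurrences can be split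
  off.\<close>

lemma inc_trees_exchange:
  assumes fin: "finite M" and t: "t \<in> inc_trees k M"
    and r: "r1 \<in># family t" "r2 \<in># family t" "r1 \<noteq> r2"
    and fam: "family t' + {#r1, r2#} = family t + {#s1, s2#}"
    and s: "admissible k s1" "admissible k s2" "fst s1 = fst r1" "fst s2 = fst r2"
  obtains N where "t' \<in> inc_trees k M" "family t = N + {#r1, r2#}" "family t' = N + {#s1, s2#}"
proof -
  obtain N1 where N1: "family t = add_mset r1 N1"
    using r(1) by (metis multi_member_split)
  then obtain N where "N1 = add_mset r2 N"
    using r(2,3) by (metis insert_noteq_member multi_member_split)
  with N1 have N: "family t = N + {#r1, r2#}" by simp
  have N': "family t' = N + {#s1, s2#}"
    using fam by (simp add: N)
  have "t' \<in> inc_trees k M"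
    using t s unfolding inc_trees_iff[OF fin] by (auto simp: N N')
  with N N' show thesis using that by blast
qed

section \<open>The two moves, and the theorem\<close>

lemma merge_up_types:
  assumes fin: "finite M" and t: "T \<in> inc_trees k M" and x: "x \<in> M"
    and old: "is_old T (node_of T x)" and int: "is_internal T (node_of T x)"
  defines "T' \<equiv> merge_up T (node_of T x)"
  shows "T' \<in> inc_trees k M"
    and "is_young T' (node_of T' x) \<and> is_leaf T' (node_of T' x)"
    and "\<forall>y\<in>M. y \<noteq> x \<longrightarrow>
      (is_old T' (node_of T' y) \<longleftrightarrow> is_old T (node_of T y)) \<and>
      (is_young T' (node_of T' y) \<longleftrightarrow> is_young T (node_of T y)) \<and>
      (is_leaf T' (node_of T' y) \<longleftrightarrow> is_leaf T (node_of T y)) \<and>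
      (is_internal T' (node_of T' y) \<longleftrightarrow> is_internal T (node_of T y))"
proof -
  interpret inc_tree k M T using fin t by unfold_locales
  obtain u i j where v: "node_of T x = u @ [i, j]" and u: "u \<in> even_nodes T"
    using even_node_nonrootE[OF node_of(1)[OF x]] old by (auto simp: is_old_def)
  have vE: "u @ [i, j] \<in> even_nodes T" and lv: "label T (u @ [i, j]) = x"
    using node_of[OF x] by (simp_all add: v)
  define r1 r2 where "r1 = local_data (subtree T u)" and "r2 = local_data (subtree T (u @ [i, j]))"
  have adm: "admissible k r1" "admissible k r2"
    using u vE admissible_local_data by (auto simp: r1_def r2_def)
  have f2: "fst r2 = Some x"
    using lab_subtree[OF vE] lv by (simp add: r2_def)
  have xr: "x \<in> entries r1"
    using u vE lv by (auto simp: r1_def entries_local_data_subtree)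
  have max: "z \<le> x" if "z \<in> entries r1" for z
    using old that by (simp add: v is_old_append_iff[OF vE u] r1_def lv)
  have ne: "snd r2 \<noteq> []" and ne1: "snd r1 \<noteq> []"
    using int xr by (auto simp: is_internal_def v r2_def entries_def)
  \<comment> \<open>Neither datum is childless, so both have exactly k rows, and zipping them loses
    nothing.\<close>
  have len: "length (snd r1) = length (snd r2)" and B: "entries r2 \<noteq> {}"
    using adm ne ne1 by (auto simp: admissible_def)
  have gt: "x < z" if "z \<in> entries r2" for z
    using adm(2) f2 that by (auto simp: admissible_def)
  have "r1 \<noteq> r2" using xr gt by blast
  moreover have "r1 \<in># family T" "r2 \<in># family T"
    using u vE by (auto simp: set_mset_family r1_def r2_def)
  moreover have "family T' + {#r1, r2#} = family T + {#merge_data r1 r2, (Some x, [])#}"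
    using family_merge_up[OF vE] len lab_subtree[OF vE]
    by (simp add: T'_def v r1_def r2_def lv)
  moreover have "admissible k (merge_data r1 r2)"
    using admissible_merge_data[OF adm f2 xr max len] .
  moreover have "admissible k (Some x, [])"
    by (simp add: admissible_def entries_def)
  ultimately obtain N where T': "T' \<in> inc_trees k M"
    and N: "family T = N + {#r1, r2#}" "family T' = N + {#merge_data r1 r2, (Some x, [])#}"
    using inc_trees_exchange[OF fin t, of r1 r2 T' "merge_data r1 r2" "(Some x, [])"] f2 by auto
  note types = types_of_merge[OF fin t T' x N fst_merge_data f2 entries_merge_data[OF len] xr max gt B]
  show "T' \<in> inc_trees k M" by fact
  show "is_young T' (node_of T' x) \<and> is_leaf T' (node_of T' x)" by (rule types)
  show "\<forall>y\<in>M. y \<noteq> x \<longrightarrow>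
      (is_old T' (node_of T' y) \<longleftrightarrow> is_old T (node_of T y)) \<and>
      (is_young T' (node_of T' y) \<longleftrightarrow> is_young T (node_of T y)) \<and>
      (is_leaf T' (node_of T' y) \<longleftrightarrow> is_leaf T (node_of T y)) \<and>
      (is_internal T' (node_of T' y) \<longleftrightarrow> is_internal T (node_of T y))"
    by (rule types)
qed

lemma split_down_types:
  assumes fin: "finite M" and t: "T \<in> inc_trees k M" and x: "x \<in> M"
    and young: "is_young T (node_of T x)" and leaf: "is_leaf T (node_of T x)"
  defines "T' \<equiv> split_down T (node_of T x)"
  shows "T' \<in> inc_trees k M"
    and "is_old T' (node_of T' x) \<and> is_internal T' (node_of T' x)"
    and "\<forall>y\<in>M. y \<noteq> x \<longrightarrow>
      (is_old T' (node_of T' y) \<longleftrightarrow> is_old T (node_of T y)) \<and>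
      (is_young T' (node_of T' y) \<longleftrightarrow> is_young T (node_of T y)) \<and>
      (is_leaf T' (node_of T' y) \<longleftrightarrow> is_leaf T (node_of T y)) \<and>
      (is_internal T' (node_of T' y) \<longleftrightarrow> is_internal T (node_of T y))"
proof -
  interpret inc_tree k M T using fin t by unfold_locales
  obtain u i j where v: "node_of T x = u @ [i, j]" and u: "u \<in> even_nodes T"
    using even_node_nonrootE[OF node_of(1)[OF x]] young by (auto simp: is_young_def)
  have vE: "u @ [i, j] \<in> even_nodes T" and lv: "label T (u @ [i, j]) = x"
    using node_of[OF x] by (simp_all add: v)
  define r where "r = local_data (subtree T u)"
  have adm: "admissible k r"
    using u admissible_local_data by (auto simp: r_def)
  have xr: "x \<in> entries r"
    using u vE lv by (auto simp: r_def entries_local_data_subtree)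
  have "\<not> is_old T (u @ [i, j])"
    using young by (simp add: v is_young_def)
  then obtain z where z: "z \<in> entries r" "x < z"
    by (auto simp: is_old_append_iff[OF vE u] r_def lv not_le)
  have kv: "kids (subtree T (u @ [i, j])) = []" and labv: "lab (subtree T (u @ [i, j])) = Some x"
    using leaf lab_subtree[OF vE] by (simp_all add: is_leaf_def v lv)
  have "r \<noteq> (Some x, [])" using xr by (auto simp: entries_def)
  moreover have "r \<in># family T"
    using u by (auto simp: set_mset_family r_def)
  moreover have "(Some x, []) \<in># family T"
    using vE kv labv by (force simp: set_mset_family local_data_def)
  moreover have "family T' + {#r, (Some x, [])#} = family T + {#lower_data x r, upper_data x r#}"
    using family_split_down[OF vE kv labv] by (simp add: T'_def v r_def)
  ultimately obtain N where T': "T' \<in> inc_trees k M"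
    and N: "family T = N + {#r, (Some x, [])#}" "family T' = N + {#lower_data x r, upper_data x r#}"
    using inc_trees_exchange[OF fin t, of r "(Some x, [])" T' "lower_data x r" "upper_data x r"]
      admissible_lower_data[OF adm xr] admissible_upper_data[OF adm z] by auto
  have E: "entries r = entries (lower_data x r) \<union> entries (upper_data x r)"
    "x \<in> entries (lower_data x r)" "\<And>z. z \<in> entries (lower_data x r) \<Longrightarrow> z \<le> x"
    "\<And>z. z \<in> entries (upper_data x r) \<Longrightarrow> x < z" "entries (upper_data x r) \<noteq> {}"
    using xr z by (auto simp: entries_lower_data entries_upper_data)
  note types = types_of_merge[OF fin T' t x N(2,1) fst_lower_data[symmetric] fst_upper_data E]
  show "T' \<in> inc_trees k M" by fact
  show "is_old T' (node_of T' x) \<and> is_internal T' (node_of T' x)" by (rule types)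
  show "\<forall>y\<in>M. y \<noteq> x \<longrightarrow>
      (is_old T' (node_of T' y) \<longleftrightarrow> is_old T (node_of T y)) \<and>
      (is_young T' (node_of T' y) \<longleftrightarrow> is_young T (node_of T y)) \<and>
      (is_leaf T' (node_of T' y) \<longleftrightarrow> is_leaf T (node_of T y)) \<and>
      (is_internal T' (node_of T' y) \<longleftrightarrow> is_internal T (node_of T y))"
    using types(3) by simp
qed

theorem lemma4p2:
  fixes k :: nat and M :: "nat set" and T :: "nat option otree" and x :: nat
  assumes "k \<ge> 1"
    and "finite M"
    and "\<forall>m\<in>M. 0 < m"
    and "T \<in> inc_trees k M"
    and "x \<in> M"
  shows "Phi x T \<in> inc_trees k M \<and>
    (is_old T (node_of T x) \<and> is_internal T (node_of T x) \<longleftrightarrow>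
     is_young (Phi x T) (node_of (Phi x T) x) \<and> is_leaf (Phi x T) (node_of (Phi x T) x)) \<and>
    (\<forall>y\<in>M. y \<noteq> x \<longrightarrow>
      (is_old (Phi x T) (node_of (Phi x T) y) \<longleftrightarrow> is_old T (node_of T y)) \<and>
      (is_young (Phi x T) (node_of (Phi x T) y) \<longleftrightarrow> is_young T (node_of T y)) \<and>
      (is_leaf (Phi x T) (node_of (Phi x T) y) \<longleftrightarrow> is_leaf T (node_of T y)) \<and>
      (is_internal (Phi x T) (node_of (Phi x T) y) \<longleftrightarrow> is_internal T (node_of T y)))"
proof -
  let ?v = "node_of T x"
  \<comment> \<open>These exclusions settle the equivalence for x in the splitting case: x is not
    old before and not young after, so both sides are false.\<close>
  have excl: "\<not> (is_young t p \<and> is_old t p)" "\<not> (is_leaf t p \<and> is_internal t p)" for t p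
    by (auto simp: is_young_def is_leaf_def is_internal_def)
  consider (merge) "is_old T ?v" "is_internal T ?v" | (split) "is_young T ?v" "is_leaf T ?v"
    | (fixed) "\<not> (is_old T ?v \<and> is_internal T ?v)" "\<not> (is_young T ?v \<and> is_leaf T ?v)"
    by blast
  then show ?thesis
  proof cases
    case merge
    then have "Phi x T = merge_up T ?v" by (simp add: Phi_def Let_def)
    then show ?thesis
      using merge merge_up_types[OF assms(2,4,5) merge] by simp
  next
    case split
    then have "\<not> is_old T ?v" using excl by blast
    with split have "Phi x T = split_down T ?v" by (simp add: Phi_def Let_def)
    then show ?thesis
      using \<open>\<not> is_old T ?v\<close> split_down_types[OF assms(2,4,5) split] excl by simp metis
  next
    case fixed
    then have "Phi x T = T" by (auto simp: Phi_def Let_def)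
    then show ?thesis using fixed assms(4) by auto
  qed
qed

end
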